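(* Let $X$ be a graph with Laplacian matrix $L$. Suppose the characteristic polynomial of $L$ factors as \[\phi(L,x)=f_1(x)^{m_1}\cdots f_k(x)^{m_k},\] where each $f_i$ is irreducible over $\mathbb{Q}$, and $\gcd(f_i,f_j)=1$ whenever $i\ne j$. For each $i$ and each vertex $u$, let \[\psi_{i,u}(L,x)=m_i\,\frac{\phi_u^{(m_i-1)}(L,x)}{\phi^{(m_i)}(L,x)}.\] Then \[\operatorname{tr}(X)=\sum_{i=1}^k\sum_{u\in V(X)}\operatorname{tr}^{\mathbb{Q}[x]/(f_i)}_{\mathbb{Q}}\,\psi_{i,u}^2(L,x).\]
   Context: Graphs are finite and simple. For a graph $X$ with Laplacian $L=D-A$ and spectral decomposition $L=\sum_\lambda \lambda E_\lambda$ (over distinct eigenvalues, $E_\lambda$ the orthogonal projection onto the $\lambda$-eigenspace), the laziness is $\operatorname{tr}(X):=\operatorname{tr}\left(\sum_\lambda E_\lambda\circ E_\lambda\right)=\sum_\lambda\sum_{u}((E_\lambda)_{uu})^2$, where $\circ$ is the entrywise product. $\phi(L,x)=\det(xI-L)$; for a vertex $u$, $L\backslash u$ is $L$ with the $u$-th row and column deleted and $\phi_u(L,x)=\det(xI-L\backslash u)$. $f^{(m)}(x)$ denotes the $m$-th derivative of $f$ with respect to $x$. For $f,g\in\mathbb{Q}[x]$ with $f\neq 0$, $\operatorname{tr}^{\mathbb{Q}[x]/(f)}_{\mathbb{Q}}g(x)$ is the trace of the $\mathbb{Q}$-linear map $\mathbb{Q}[x]/(f)\to\mathbb{Q}[x]/(f)$,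 $h(x)\mapsto h(x)g(x) \bmod f(x)$. The rational function $\psi_{i,u}(L,x)$ is interpreted as an element of the field $\mathbb{Q}[x]/(f_i)$: its denominator $\phi^{(m_i)}(L,x)$ is coprime to $f_i$, hence invertible modulo $f_i$. *)

theory Defs
  imports
    Complex_Main
    "HOL-Computational_Algebra.Field_as_Ring"
    "HOL-Computational_Algebra.Polynomial_Factorial"
    "HOL-Number_Theory.Modular_Inverse"
    "Graph_Theory.Pair_Digraph"
    "Jordan_Normal_Form.Char_Poly"
begin

text \<open>
  A finite simple graph is a \<open>pair_graph\<close>: a finite, loop-free digraph whose arc set is a
  symmetric relation on the vertices. The rows and columns of its matrices are indexed by
  positions in a list \<open>vs\<close> enumerating the vertex set without repetition.
\<close>

definition degree_mat :: "'a pair_pre_digraph \<Rightarrow> 'a list \<Rightarrow> 'b::comm_ring_1 mat" where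
  "degree_mat G vs = mat (length vs) (length vs)
     (\<lambda>(i, j). if i = j then of_nat (out_degree (with_proj G) (vs ! i)) else 0)"

definition adjacency_mat :: "'a pair_pre_digraph \<Rightarrow> 'a list \<Rightarrow> 'b::comm_ring_1 mat" where
  "adjacency_mat G vs = mat (length vs) (length vs)
     (\<lambda>(i, j). if (vs ! i, vs ! j) \<in> parcs G then 1 else 0)"

text \<open>
  The coefficient ring is left open: eigenvalues and projections live over the reals,
  characteristic polynomials over the rationals.
\<close>

definition laplacian :: "'a pair_pre_digraph \<Rightarrow> 'a list \<Rightarrow> 'b::comm_ring_1 mat" where
  "laplacian G vs = degree_mat G vs - adjacency_mat G vs"

definition eigenspace :: "'b::comm_ring_1 mat \<Rightarrow> 'b \<Rightarrow> 'b vec set" where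
  "eigenspace A c = {v \<in> carrier_vec (dim_row A). A *\<^sub>v v = c \<cdot>\<^sub>v v}"

text \<open>
  The matrix of the orthogonal projection onto a linear subspace \<open>W\<close> of \<open>n\<close>-dimensional real
  space: it sends \<open>v\<close> to the unique element of \<open>W\<close> that differs from \<open>v\<close> by a vector
  orthogonal to \<open>W\<close>. Such a matrix exists and is unique for every subspace \<open>W\<close>.
\<close>

definition orth_proj_mat :: "nat \<Rightarrow> real vec set \<Rightarrow> real mat" where
  "orth_proj_mat n W = (THE P. P \<in> carrier_mat n n \<and>
     (\<forall>v \<in> carrier_vec n. P *\<^sub>v v \<in> W \<and> (\<forall>w \<in> W. (v - P *\<^sub>v v) \<bullet> w = 0)))"

definition spectral_idempotent :: "real mat \<Rightarrow> real \<Rightarrow> real mat" where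
  "spectral_idempotent A c = orth_proj_mat (dim_row A) (eigenspace A c)"

definition laziness :: "'a pair_pre_digraph \<Rightarrow> 'a list \<Rightarrow> real" where
  "laziness G vs = (\<Sum>c | eigenvalue (laplacian G vs) c.
     \<Sum>u<length vs. (spectral_idempotent (laplacian G vs) c $$ (u, u))\<^sup>2)"

definition lap_poly :: "'a pair_pre_digraph \<Rightarrow> 'a list \<Rightarrow> rat poly" where
  "lap_poly G vs = char_poly (laplacian G vs)"

definition lap_poly_del :: "'a pair_pre_digraph \<Rightarrow> 'a list \<Rightarrow> nat \<Rightarrow> rat poly" where
  "lap_poly_del G vs u = char_poly (mat_delete (laplacian G vs) u u)"

text \<open>
  Elements of the quotient of the rational polynomial ring by \<open>(f)\<close>, \<open>f \<noteq> 0\<close>, are represented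
  by polynomials modulo \<open>f\<close>. The residues of \<open>1, x, \<dots>, x ^ (degree f - 1)\<close> form a basis of
  the quotient, and \<open>quot_trace f g\<close> is the trace of the matrix of \<open>quot_mult f g\<close> in this basis.
\<close>

definition quot_mult :: "rat poly \<Rightarrow> rat poly \<Rightarrow> rat poly \<Rightarrow> rat poly" where
  "quot_mult f g h = (h * g) mod f"

definition quot_trace :: "rat poly \<Rightarrow> rat poly \<Rightarrow> rat" where
  "quot_trace f g = (\<Sum>j<degree f. coeff (quot_mult f g (monom 1 j)) j)"

text \<open>
  \<open>m\<close> times the quotient of the \<open>(m - 1)\<close>-st derivative of \<open>lap_poly_del\<close> by the \<open>m\<close>-th
  derivative of \<open>lap_poly\<close>, as a residue modulo \<open>f\<close>; division is multiplication
  by the inverse modulo \<open>f\<close>, which exists when the denominator is coprime to \<open>f\<close>.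
\<close>

definition psi :: "'a pair_pre_digraph \<Rightarrow> 'a list \<Rightarrow> rat poly \<Rightarrow> nat \<Rightarrow> nat \<Rightarrow> rat poly" where
  "psi G vs f m u =
     (of_nat m * (pderiv ^^ (m - 1)) (lap_poly_del G vs u)
        * modular_inverse f ((pderiv ^^ m) (lap_poly G vs))) mod f"

end

theory Submission
  imports Defs "Jordan_Normal_Form.Schur_Decomposition"
begin

text \<open>
  Diagonalise \<open>L = Q D Q\<^sup>T\<close> with \<open>Q\<close> orthogonal. Then \<open>\<phi>\<close> is the product of the \<open>x - d\<^sub>i\<close>, and
  \<open>\<phi>\<^sub>u\<close>, a diagonal entry of the adjugate of \<open>x I - L\<close>, is
  \<open>\<Sum>\<^sub>\<lambda> (E\<^sub>\<lambda>)\<^sub>u\<^sub>u \<phi> / (x - \<lambda>)\<close>. Comparing leading Taylor coefficients at a root \<open>\<lambda>\<close> of \<open>f\<^sub>i\<close>,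
  which has multiplicity exactly \<open>m\<^sub>i\<close> in \<open>\<phi>\<close>, shows that \<open>\<psi>\<^sub>i\<^sub>,\<^sub>u\<close> takes the value
  \<open>(E\<^sub>\<lambda>)\<^sub>u\<^sub>u\<close> there. Since \<open>f\<^sub>i\<close> has only simple roots, all of them real, the trace of
  multiplication by \<open>g\<close> on the quotient by \<open>f\<^sub>i\<close> is the sum of \<open>g\<close> over these roots, and the
  root sets of the \<open>f\<^sub>i\<close> partition the eigenvalues.
\<close>

section \<open>Roots and derivatives of split polynomials\<close>

text \<open>Differentiating \<open>X^(m+1) * g\<close>, with \<open>X\<close> the linear factor at
  \<open>a\<close>, gives \<open>X^m * ((m+1) g + X g')\<close>. This has the same shape with one
  power fewer, so the induction runs with \<open>g\<close> arbitrary, and the term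
  \<open>X g'\<close> vanishes at \<open>a\<close>.\<close>

lemma poly_higher_pderiv_linear_power:
  fixes a :: "'a::{idom, semiring_char_0}"
  shows "poly ((pderiv ^^ m) ([:- a, 1:] ^ m * g)) a = fact m * poly g a"
proof (induction m arbitrary: g)
  case (Suc m)
  have "pderiv [:- a, 1:] = 1"
    by (simp add: pderiv_pCons)
  then have "pderiv ([:- a, 1:] ^ Suc m * g)
      = [:- a, 1:] ^ m * (Polynomial.smult (of_nat (Suc m)) g + [:- a, 1:] * pderiv g)"
    unfolding pderiv_mult pderiv_power_Suc unfolding power_Suc
    by (simp only: mult_1_left mult_1_right mult_smult_left mult_smult_right distrib_left ac_simps)
  then have "(pderiv ^^ Suc m) ([:- a, 1:] ^ Suc m * g)
      = (pderiv ^^ m) ([:- a, 1:] ^ m * (Polynomial.smult (of_nat (Suc m)) g + [:- a, 1:] * pderiv g))"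
    by (simp only: funpow_Suc_right o_apply)
  then show ?case
    by (simp only: Suc.IH) (simp add: algebra_simps)
qed simp

text \<open>Unique factorisation, one linear factor at a time: either \<open>d x\<close> is a root
  of \<open>p\<close> and the factor cancels on both sides, or the factor is coprime to
  \<open>p\<close> and drops out of the product. Choosing indices instead of roots lets repeated
  values of \<open>d\<close> count with multiplicity.\<close>

lemma dvd_prod_linear:
  fixes p :: "'a::field_gcd poly"
  assumes "finite S" "p dvd (\<Prod>i\<in>S. [:- d i, 1:])"
  shows "\<exists>T\<subseteq>S. \<exists>c. p = Polynomial.smult c (\<Prod>i\<in>T. [:- d i, 1:])"
  using assms
proof (induction S arbitrary: p rule: finite_induct)
  case empty
  then obtain c where "p = [:c:]"
    by (auto simp: is_unit_iff_degree elim: degree_eq_zeroE split: if_splits)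
  then show ?case
    by (intro exI[of _ "{}"] conjI exI[of _ c]) auto
next
  case (insert x S)
  show ?case
  proof (cases "poly p (d x) = 0")
    case True
    then obtain q where q: "p = [:- d x, 1:] * q"
      by (auto simp: poly_eq_0_iff_dvd)
    have "[:- d x, 1:] * q dvd [:- d x, 1:] * (\<Prod>i\<in>S. [:- d i, 1:])"
      using insert.prems insert.hyps by (simp only: prod.insert q not_False_eq_True)
    then have "q dvd (\<Prod>i\<in>S. [:- d i, 1:])"
      by (simp only: dvd_mult_cancel_left) simp
    then obtain T c where T: "T \<subseteq> S" "q = Polynomial.smult c (\<Prod>i\<in>T. [:- d i, 1:])"
      using insert.IH by blast
    have "x \<notin> T" "finite T"
      using T insert.hyps finite_subset by auto
    then show ?thesis
      using T q by (intro exI[of _ "insert x T"] conjI exI[of _ c]) auto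
  next
    case False
    then have "\<not> [:- d x, 1:] dvd p"
      by (simp add: poly_eq_0_iff_dvd)
    then have "coprime p [:- d x, 1:]"
      using prime_elem_imp_coprime[of "[:- d x, 1:]" p]
      by (simp add: coprime_commute prime_elem_linear_field_poly)
    moreover have "p dvd [:- d x, 1:] * (\<Prod>i\<in>S. [:- d i, 1:])"
      using insert.prems insert.hyps by (simp only: prod.insert not_False_eq_True)
    ultimately have "p dvd (\<Prod>i\<in>S. [:- d i, 1:])"
      by (simp only: coprime_dvd_mult_right_iff)
    then show ?thesis
      using insert.IH by blast
  qed
qed

text \<open>The divisor \<open>p\<close> is itself a product of linear factors over an index set
  \<open>T\<close>. Simplicity of the roots forces \<open>d\<close> to be injective on
  \<open>T\<close>, so roots, indices and degree agree in number.\<close>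

lemma card_roots_eq_degree:
  fixes p :: "'a::field_gcd poly"
  assumes "finite S" "p dvd (\<Prod>i\<in>S. [:- d i, 1:])"
    and simple: "\<And>x. poly p x = 0 \<Longrightarrow> poly (pderiv p) x \<noteq> 0"
  shows "card {x. poly p x = 0} = degree p"
proof -
  obtain T c where T: "T \<subseteq> S" and p: "p = Polynomial.smult c (\<Prod>i\<in>T. [:- d i, 1:])"
    using dvd_prod_linear[OF assms(1,2)] by blast
  have fT: "finite T"
    using T assms(1) finite_subset by blast
  have c: "c \<noteq> 0"
  proof
    assume "c = 0"
    then have "p = 0" using p by simp
    \<comment> \<open>The zero polynomial would vanish at \<open>0\<close> together with its
      derivative.\<close>
    then show False using simple[of 0] by simp
  qed
  have "inj_on d T"
  proof (rule inj_onI, rule ccontr)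
    \<comment> \<open>Two indices with the same value would give \<open>p\<close> a square factor,
      hence a common root of \<open>p\<close> and \<open>pderiv p\<close>.\<close>
    fix i j assume ij: "i \<in> T" "j \<in> T" "d i = d j" "i \<noteq> j"
    have "(\<Prod>i\<in>T. [:- d i, 1:]) = [:- d i, 1:] * ([:- d i, 1:] * (\<Prod>i\<in>T - {i} - {j}. [:- d i, 1:]))"
      using ij fT by (subst prod.remove[of _ i], simp, simp, subst prod.remove[of _ j]) auto
    then have "p = Polynomial.smult c ([:- d i, 1:] * ([:- d i, 1:] * (\<Prod>i\<in>T - {i} - {j}. [:- d i, 1:])))"
      using p by simp
    then have "poly p (d i) = 0" "poly (pderiv p) (d i) = 0"
      by (simp_all only: pderiv_smult pderiv_mult poly_smult poly_mult poly_add) simp_all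
    then show False
      using simple by blast
  qed
  moreover have "{x. poly p x = 0} = d ` T"
    using fT c by (auto simp: p poly_prod)
  moreover have "degree p = card T"
    using c by (simp add: p degree_prod_eq_sum_degree)
  ultimately show ?thesis
    by (simp add: card_image)
qed

lemma order_linear_power_mult:
  fixes g :: "'a::idom poly"
  assumes "poly g a \<noteq> 0"
  shows "Polynomial.order a ([:- a, 1:] ^ m * g) = m"
proof -
  have "g \<noteq> 0"
    using assms by auto
  then have "[:- a, 1:] ^ m * g \<noteq> 0"
    by simp
  then show ?thesis
    using assms by (simp add: order_mult order_power_n_n order_0I)
qed

lemma prod_linear_split:
  assumes "finite I"
  shows "(\<Prod>i\<in>I. [:- d i, 1:]) = [:- a, 1:] ^ card {i \<in> I. d i = a} * (\<Prod>i\<in>{i \<in> I. d i \<noteq> a}. [:- d i, 1:])"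
proof -
  have "(\<Prod>i\<in>I. [:- d i, 1:]) = (\<Prod>i\<in>{i \<in> I. d i = a}. [:- d i, 1:]) * (\<Prod>i\<in>{i \<in> I. d i \<noteq> a}. [:- d i, 1:])"
    using assms by (subst prod.union_disjoint[symmetric]) (auto intro!: prod.cong)
  also have "(\<Prod>i\<in>{i \<in> I. d i = a}. [:- d i, 1:]) = (\<Prod>i\<in>{i \<in> I. d i = a}. [:- a, 1:])"
    by (rule prod.cong) auto
  finally show ?thesis
    by simp
qed

lemma order_prod_linear:
  fixes d :: "'i \<Rightarrow> 'a::idom"
  assumes "finite I"
  shows "Polynomial.order a (\<Prod>i\<in>I. [:- d i, 1:]) = card {i \<in> I. d i = a}"
  unfolding prod_linear_split[OF assms, of d a]
  using assms by (intro order_linear_power_mult) (auto simp: poly_prod)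

text \<open>\<open>q\<close> is the sum of the \<open>w i * p / (x - d i)\<close>, written without
  division. With \<open>X = x - a\<close> and \<open>p = X^m * g\<close>, the terms of
  \<open>q\<close> with \<open>d i = a\<close> are \<open>w i * X^(m-1) * g\<close>, and all others
  are divisible by \<open>X^m\<close>. Hence the coefficient of \<open>X^(m-1)\<close> in
  \<open>q\<close> is that of \<open>X^m\<close> in \<open>p\<close> times the total weight at
  \<open>a\<close>.\<close>

lemma higher_pderiv_partial_fraction:
  fixes d w :: "'i \<Rightarrow> 'a::field_char_0"
  assumes I: "finite I" and m: "m = card {i \<in> I. d i = a}" "m > 0"
  defines "p \<equiv> \<Prod>i\<in>I. [:- d i, 1:]"
    and "q \<equiv> \<Sum>i\<in>I. Polynomial.smult (w i) (\<Prod>j\<in>I - {i}. [:- d j, 1:])"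
  shows "of_nat m * poly ((pderiv ^^ (m - 1)) q) a
      = (\<Sum>i\<in>{i \<in> I. d i = a}. w i) * poly ((pderiv ^^ m) p) a"
    and "poly ((pderiv ^^ m) p) a \<noteq> 0"
proof -
  let ?S = "{i \<in> I. d i = a}" and ?T = "{i \<in> I. d i \<noteq> a}"
  let ?X = "[:- a, 1:]"
  define g where "g = (\<Prod>i\<in>?T. [:- d i, 1:])"
  define h where "h = (\<Sum>i\<in>?T. Polynomial.smult (w i) (\<Prod>j\<in>?T - {i}. [:- d j, 1:]))"
  have ga: "poly g a \<noteq> 0"
    using I by (auto simp: g_def poly_prod)
  note m1 = power_minus_mult[OF m(2), of ?X, symmetric]
  have p: "p = ?X ^ m * g"
    unfolding p_def g_def m(1) by (rule prod_linear_split[OF I])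
  have inS: "(\<Prod>j\<in>I - {i}. [:- d j, 1:]) = ?X ^ (m - 1) * g" if "i \<in> ?S" for i
  proof -
    have "{j \<in> I - {i}. d j = a} = ?S - {i}" "{j \<in> I - {i}. d j \<noteq> a} = ?T"
      using that by auto
    moreover have "card (?S - {i}) = m - 1"
      using that I m(1) by simp
    ultimately show ?thesis
      unfolding prod_linear_split[OF finite_Diff[OF I], of d "{i}" a] g_def by (simp only:)
  qed
  \<comment> \<open>Removing an index with \<open>d i \<noteq> a\<close> leaves all \<open>m\<close>
    factors \<open>X\<close>. One of them is kept apart, since it makes the term vanish at
    \<open>a\<close> after \<open>m - 1\<close> derivatives.\<close>
  have inT: "(\<Prod>j\<in>I - {i}. [:- d j, 1:]) = ?X ^ (m - 1) * (?X * (\<Prod>j\<in>?T - {i}. [:- d j, 1:]))"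
    if "i \<in> ?T" for i
  proof -
    have "{j \<in> I - {i}. d j = a} = ?S" "{j \<in> I - {i}. d j \<noteq> a} = ?T - {i}"
      using that by auto
    then show ?thesis
      unfolding prod_linear_split[OF finite_Diff[OF I], of d "{i}" a]
      by (simp only: m(1)[symmetric] m1 mult.assoc)
  qed
  have "q = (\<Sum>i\<in>?S. Polynomial.smult (w i) (\<Prod>j\<in>I - {i}. [:- d j, 1:]))
      + (\<Sum>i\<in>?T. Polynomial.smult (w i) (\<Prod>j\<in>I - {i}. [:- d j, 1:]))"
    unfolding q_def using I by (subst sum.union_disjoint[symmetric]) (auto intro!: sum.cong)
  also have "\<dots> = (\<Sum>i\<in>?S. ?X ^ (m - 1) * Polynomial.smult (w i) g)
      + (\<Sum>i\<in>?T. ?X ^ (m - 1) * (?X * Polynomial.smult (w i) (\<Prod>j\<in>?T - {i}. [:- d j, 1:])))"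
    by (intro arg_cong2[of _ _ _ _ plus] sum.cong refl) (simp_all only: inS inT mult_smult_right)
  also have "\<dots> = ?X ^ (m - 1) * ((\<Sum>i\<in>?S. Polynomial.smult (w i) g) + ?X * h)"
    unfolding h_def by (simp only: sum_distrib_left distrib_left)
  finally have q: "q = ?X ^ (m - 1) * ((\<Sum>i\<in>?S. Polynomial.smult (w i) g) + ?X * h)" .
  have "poly ((\<Sum>i\<in>?S. Polynomial.smult (w i) g) + ?X * h) a = (\<Sum>i\<in>?S. w i) * poly g a"
    by (simp add: poly_sum sum_distrib_right)
  \<comment> \<open>The factor \<open>m\<close> turns \<open>(m-1)!\<close> into
    \<open>m!\<close>.\<close>
  then show "of_nat m * poly ((pderiv ^^ (m - 1)) q) a = (\<Sum>i\<in>?S. w i) * poly ((pderiv ^^ m) p) a"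
    unfolding p q poly_higher_pderiv_linear_power by (simp only: fact_reduce[OF m(2)] mult_ac)
  show "poly ((pderiv ^^ m) p) a \<noteq> 0"
    unfolding p poly_higher_pderiv_linear_power using ga by simp
qed

section \<open>The trace of a polynomial quotient as a sum over roots\<close>

definition lagrange_basis :: "'a::field set \<Rightarrow> 'a \<Rightarrow> 'a poly" where
  "lagrange_basis R a = Polynomial.smult (inverse (\<Prod>b\<in>R - {a}. a - b)) (\<Prod>b\<in>R - {a}. [:- b, 1:])"

lemma poly_lagrange_basis:
  assumes "finite R" "a \<in> R" "b \<in> R"
  shows "poly (lagrange_basis R a) b = (if a = b then 1 else 0)"
proof (cases "a = b")
  case True
  then show ?thesis
    using assms(1) by (simp add: lagrange_basis_def poly_prod)
next
  case False
  then have "(\<Prod>c\<in>R - {a}. b - c) = 0"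
    using assms by auto
  then show ?thesis
    using False by (simp add: lagrange_basis_def poly_prod)
qed

lemma degree_lagrange_basis_less:
  assumes "finite R" "a \<in> R"
  shows "degree (lagrange_basis R a) < card R"
proof -
  have "degree (lagrange_basis R a) \<le> card (R - {a})"
    unfolding lagrange_basis_def
    by (rule order.trans[OF degree_smult_le]) (simp add: degree_prod_eq_sum_degree)
  also have "\<dots> < card R"
    using assms by (rule card_Diff1_less)
  finally show ?thesis .
qed

text \<open>Both sides have degree below \<open>card R\<close> and agree at the points of
  \<open>R\<close>.\<close>

lemma lagrange_interpolation:
  assumes "finite R" "degree h < card R"
  shows "h = (\<Sum>a\<in>R. Polynomial.smult (poly h a) (lagrange_basis R a))"
proof (rule poly_eqI_degree[of R])
  show "poly h b = poly (\<Sum>a\<in>R. Polynomial.smult (poly h a) (lagrange_basis R a)) b" if "b \<in> R" for b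
    using that assms(1) by (simp add: poly_sum poly_lagrange_basis if_distrib sum.delta cong: if_cong)
  show "degree (\<Sum>a\<in>R. Polynomial.smult (poly h a) (lagrange_basis R a)) < card R"
    using assms degree_lagrange_basis_less[of R]
    by (intro degree_sum_less) (auto intro: le_less_trans[OF degree_smult_le])
qed (use assms in simp)

interpretation of_rat_poly_hom: map_poly_comm_ring_hom of_rat ..

text \<open>Evaluation at a root of \<open>f\<close> factors through the quotient by
  \<open>f\<close>, so a residue has a value there that does not depend on its
  representative.\<close>

lemma poly_hom_mod_root:
  fixes x :: "'a::field_char_0"
  assumes "poly (map_poly of_rat f) x = 0"
  shows "poly (map_poly of_rat (p mod f)) x = poly (map_poly of_rat p) x"
proof -
  have "p = (p div f) * f + p mod f" by simp
  then have "map_poly of_rat p = map_poly of_rat (p div f) * map_poly of_rat f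
      + (map_poly of_rat (p mod f) :: 'a poly)"
    by (metis of_rat_poly_hom.hom_add of_rat_poly_hom.hom_mult)
  then show ?thesis
    using assms by simp
qed

text \<open>The hypothesis \<open>card R = degree f\<close> says that \<open>f\<close> splits over
  \<open>'a\<close> with simple roots. After extension of scalars the Lagrange polynomials at the
  roots form a basis of the quotient in which multiplication by \<open>g\<close> is diagonal, with
  the values of \<open>g\<close> as entries. The computation obtains this trace from the diagonal
  entries in the monomial basis.\<close>

lemma quot_trace_eq_sum_roots:
  fixes f g :: "rat poly"
  defines "R \<equiv> {x :: 'a::field_char_0. poly (map_poly of_rat f) x = 0}"
  assumes "f \<noteq> 0" "card R = degree f"
  shows "of_rat (quot_trace f g) = (\<Sum>x\<in>R. poly (map_poly of_rat g) x)"
proof -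
  let ?h = "map_poly of_rat :: rat poly \<Rightarrow> 'a poly"
  have fin: "finite R"
    unfolding R_def using assms(2) by (intro poly_roots_finite) simp
  \<comment> \<open>The remainder \<open>x ^ j * g mod f\<close> is interpolated at the roots of \<open>f\<close>; summing over the
    diagonal then evaluates each Lagrange basis polynomial at its own node.\<close>
  have coeff: "of_rat (coeff (quot_mult f g (monom 1 j)) j)
      = (\<Sum>x\<in>R. poly (?h g) x * (coeff (lagrange_basis R x) j * x ^ j))" if j: "j < degree f" for j
  proof -
    let ?r = "quot_mult f g (monom 1 j)"
    \<comment> \<open>\<open>j < degree f\<close> excludes a constant \<open>f\<close>, so the
      remainder has degree strictly below \<open>degree f\<close> even when it is zero.\<close>
    have "degree (?h ?r) < card R"
      using j degree_mod_less'[of f] assms(2,3)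
      by (metis (no_types, lifting) bot_nat_0.not_eq_extremum degree_0 degree_mod_less not_less_zero
          of_rat_hom.degree_map_poly_hom quot_mult_def)
    note lagrange_interpolation[OF fin this]
    then have "coeff (?h ?r) j = (\<Sum>x\<in>R. poly (?h ?r) x * coeff (lagrange_basis R x) j)"
      by (metis (no_types, lifting) coeff_smult coeff_sum sum.cong)
    also have "\<dots> = (\<Sum>x\<in>R. poly (?h g) x * (coeff (lagrange_basis R x) j * x ^ j))"
    proof (rule sum.cong[OF refl])
      fix x assume "x \<in> R"
      then have "poly (?h ?r) x = poly (?h (monom 1 j * g)) x"
        unfolding quot_mult_def R_def by (intro poly_hom_mod_root) simp
      then show "poly (?h ?r) x * coeff (lagrange_basis R x) j
          = poly (?h g) x * (coeff (lagrange_basis R x) j * x ^ j)"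
        by (simp add: of_rat_poly_hom.hom_mult of_rat_hom.map_poly_hom_monom poly_monom)
    qed
    finally show ?thesis by simp
  qed
  have "of_rat (quot_trace f g)
      = (\<Sum>x\<in>R. \<Sum>j<degree f. poly (?h g) x * (coeff (lagrange_basis R x) j * x ^ j))"
    by (subst sum.swap) (simp add: quot_trace_def of_rat_sum coeff)
  also have "\<dots> = (\<Sum>x\<in>R. poly (?h g) x * poly (lagrange_basis R x) x)"
  proof (rule sum.cong[OF refl])
    fix x assume "x \<in> R"
    \<comment> \<open>The basis polynomial has degree below \<open>degree f\<close>, so the range
      \<open>j < degree f\<close> covers its coefficients and adds only zeros.\<close>
    then have "(\<Sum>j<degree f. coeff (lagrange_basis R x) j * x ^ j) = poly (lagrange_basis R x) x"
      using degree_lagrange_basis_less[OF fin, of x] assms(3)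
      by (subst poly_altdef, intro sum.mono_neutral_right) (auto intro!: coeff_eq_0 simp: not_le)
    then show "(\<Sum>j<degree f. poly (?h g) x * (coeff (lagrange_basis R x) j * x ^ j))
        = poly (?h g) x * poly (lagrange_basis R x) x"
      by (simp add: sum_distrib_left[symmetric])
  qed
  also have "\<dots> = (\<Sum>x\<in>R. poly (?h g) x)"
    using fin by (intro sum.cong) (simp_all add: poly_lagrange_basis)
  finally show ?thesis .
qed

section \<open>Rational polynomials at roots in an extension field\<close>

text \<open>A Bezout identity over the rationals survives in the extension field and excludes a
  common zero.\<close>

lemma coprime_no_common_root:
  fixes p q :: "rat poly" and x :: "'a::field_char_0"
  assumes "coprime p q" "poly (map_poly of_rat p) x = 0"
  shows "poly (map_poly of_rat q) x \<noteq> 0"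
proof
  assume "poly (map_poly of_rat q) x = 0"
  moreover obtain a b where "a * p + b * q = 1"
    using assms(1) bezout_coefficients_fst_snd[of p q] by (metis coprime_imp_gcd_eq_1)
  then have "map_poly of_rat (a * p + b * q) = (1 :: 'a poly)"
    by simp
  then have "poly (map_poly of_rat a * map_poly of_rat p + map_poly of_rat b * map_poly of_rat q) x
      = (1::'a)"
    by (simp add: of_rat_poly_hom.hom_mult of_rat_poly_hom.hom_add)
  ultimately show False
    using assms(2) by simp
qed

text \<open>An irreducible \<open>p\<close> either divides \<open>q\<close> or is coprime to it, and
  a common root rules out the latter.\<close>

lemma irreducible_root_dvd:
  fixes p q :: "rat poly" and x :: "'a::field_char_0"
  assumes "irreducible p" "poly (map_poly of_rat p) x = 0" "poly (map_poly of_rat q) x = 0"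
  shows "p dvd q"
proof (rule ccontr)
  assume "\<not> p dvd q"
  then have "coprime p q"
    using assms(1) by (meson irreducible_imp_prime_elem_gcd prime_elem_imp_coprime)
  then show False
    using coprime_no_common_root assms by blast
qed

text \<open>A multiple root would make \<open>p\<close> divide its derivative, which in
  characteristic 0 is nonzero and of smaller degree.\<close>

lemma irreducible_simple_root:
  fixes p :: "rat poly" and x :: "'a::field_char_0"
  assumes "irreducible p" "poly (map_poly of_rat p) x = 0"
  shows "poly (pderiv (map_poly of_rat p)) x \<noteq> 0"
proof
  assume "poly (pderiv (map_poly of_rat p)) x = 0"
  then have "p dvd pderiv p"
    by (metis irreducible_root_dvd[OF assms] of_rat_hom.map_poly_pderiv)
  moreover have "degree p \<noteq> 0"
    using assms(1) is_unit_iff_degree[of p] by (auto simp: irreducible_def)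
  then have "pderiv p \<noteq> 0" "degree (pderiv p) < degree p"
    by (auto simp: pderiv_eq_0_iff degree_pderiv)
  ultimately show False
    using dvd_imp_degree_le by fastforce
qed

text \<open>Evaluation at a root is a ring homomorphism on the quotient, so it carries inverses
  modulo \<open>f\<close> to inverses in the field.\<close>

lemma modular_inverse_root:
  fixes x :: "'a::field_char_0"
  assumes "coprime q f" "poly (map_poly of_rat f) x = 0"
  shows "poly (map_poly of_rat (modular_inverse f q)) x = inverse (poly (map_poly of_rat q) x)"
proof -
  have "(q * modular_inverse f q) mod f = 1 mod f"
    using cong_modular_inverse1[OF assms(1)] by (simp add: Cong.cong_def)
  then have "poly (map_poly of_rat (q * modular_inverse f q)) x = (poly (map_poly of_rat 1) x :: 'a)"
    by (metis assms(2) poly_hom_mod_root)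
  then have "poly (map_poly of_rat q) x * poly (map_poly of_rat (modular_inverse f q)) x = 1"
    by (simp add: of_rat_poly_hom.hom_mult)
  then show ?thesis
    by (metis inverse_unique)
qed

section \<open>The spectral theorem for real symmetric matrices\<close>

text \<open>Since \<open>A\<close> is real and symmetric, it moves across the Hermitian product. For
  an eigenvector \<open>v\<close> this gives
  \<open>c * (v \<bullet>c v) = cnj c * (v \<bullet>c v)\<close>, where the product of
  \<open>v\<close> with itself is nonzero.\<close>

lemma real_symmetric_eigenvalue_real:
  fixes A :: "real mat"
  assumes A: "A \<in> carrier_mat n n" and sym: "transpose_mat A = A"
    and ev: "eigenvalue (map_mat complex_of_real A) c"
  shows "c \<in> \<real>"
proof -
  let ?A = "map_mat complex_of_real A"
  have cA: "?A \<in> carrier_mat n n"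
    using A by simp
  obtain v where v: "v \<in> carrier_vec n" "v \<noteq> 0\<^sub>v n" "?A *\<^sub>v v = c \<cdot>\<^sub>v v"
    using ev A unfolding eigenvalue_def eigenvector_def by auto
  have conj: "conjugate (?A *\<^sub>v v) = ?A *\<^sub>v conjugate v"
    using A v(1) by (intro eq_vecI) (auto simp: scalar_prod_def)
  have symc: "transpose_mat ?A = ?A"
    using sym by (metis map_mat_transpose)
  have "c * (v \<bullet>c v) = (?A *\<^sub>v v) \<bullet>c v"
    using v by simp
  also have "\<dots> = v \<bullet> (?A *\<^sub>v conjugate v)"
    using transpose_vec_mult_scalar[OF cA, of "conjugate v" v] v(1)
    by (simp add: symc comm_scalar_prod[of _ n])
  also have "\<dots> = cnj c * (v \<bullet>c v)"
    using v by (simp add: conj[symmetric] conjugate_smult_vec)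
  finally have "c = cnj c"
    using conjugate_square_eq_0_vec[OF v(1)] v(2) by simp
  then show ?thesis
    by (metis Reals_cnj_iff)
qed

text \<open>The characteristic polynomial has a complex root; the root is an eigenvalue of the
  complexified matrix, hence real.\<close>

lemma real_symmetric_has_eigenvalue:
  fixes A :: "real mat"
  assumes A: "A \<in> carrier_mat n n" and sym: "transpose_mat A = A" and "n > 0"
  shows "\<exists>c. eigenvalue A c"
proof -
  let ?A = "map_mat complex_of_real A"
  have cA: "?A \<in> carrier_mat n n"
    using A by simp
  have "degree (char_poly ?A) = n"
    using degree_monic_char_poly[OF cA] by simp
  then have "\<not> constant (poly (char_poly ?A))"
    using \<open>n > 0\<close> by (simp add: constant_degree)
  then obtain z where "poly (char_poly ?A) z = 0"
    using fundamental_theorem_of_algebra by blast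
  then have ev: "eigenvalue ?A z"
    using eigenvalue_root_char_poly[OF cA] by simp
  then obtain c where z: "z = complex_of_real c"
    using real_symmetric_eigenvalue_real[OF A sym] by (auto elim: Reals_cases)
  then have "poly (char_poly A) c = 0"
    using \<open>poly (char_poly ?A) z = 0\<close>
    by (simp add: of_real_hom.char_poly_hom[OF A])
  then show ?thesis
    using eigenvalue_root_char_poly[OF A] by blast
qed

text \<open>Gram-Schmidt on a completion of \<open>v\<close> to a basis keeps \<open>v\<close> as
  first vector. Normalising the lengths then scales it, which is where the factor \<open>c\<close>
  comes from.\<close>

lemma orthonormal_extension:
  fixes v :: "real vec"
  assumes v: "v \<in> carrier_vec n" "v \<noteq> 0\<^sub>v n"
  shows "\<exists>W c. W \<in> carrier_mat n n \<and> transpose_mat W * W = 1\<^sub>m n \<and> col W 0 = c \<cdot>\<^sub>v v"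
proof -
  interpret cof_vec_space n "TYPE(real)" .
  \<comment> \<open>\<open>corthogonal\<close> is stated with conjugation, which is trivial over the
    reals.\<close>
  have conj: "conjugate w = w" for w :: "real vec"
    by (rule eq_vecI) auto
  define ws where "ws = gram_schmidt n (basis_completion v)"
  note b = basis_completion[OF v]
  have ws: "set ws \<subseteq> carrier_vec n" "corthogonal ws" "length ws = n"
    using gram_schmidt_result[OF b(2,4,5) ws_def] b(6) by auto
  have n: "n > 0"
    using v by (cases n) auto
  then obtain bs where "basis_completion v = v # bs"
    using b(6,7) by (cases "basis_completion v") auto
  then have hd: "ws ! 0 = v"
    using gram_schmidt_hd[OF v(1), of bs] ws(3) n by (metis hd_conv_nth length_0_conv not_gr0 ws_def)
  have wc: "ws ! i \<in> carrier_vec n" if "i < n" for i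
    using ws that by auto
  define s where "s i = 1 / sqrt (ws ! i \<bullet> ws ! i)" for i
  define W where "W = mat n n (\<lambda>(i, j). s j * (ws ! j) $ i)"
  have col: "col W j = s j \<cdot>\<^sub>v ws ! j" if "j < n" for j
    using that wc[OF that] by (intro eq_vecI) (auto simp: W_def)
  have orth: "ws ! i \<bullet> ws ! j = 0 \<longleftrightarrow> i \<noteq> j" if "i < n" "j < n" for i j
    using corthogonalD[OF ws(2), of i j] that ws(3) by (simp add: conj)
  have pos: "ws ! i \<bullet> ws ! i > 0" if "i < n" for i
  proof -
    have "ws ! i \<bullet> ws ! i \<ge> 0"
      by (auto simp: scalar_prod_def intro: sum_nonneg)
    then show ?thesis
      using orth[OF that that] by simp
  qed
  have "transpose_mat W * W = 1\<^sub>m n"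
  proof (rule eq_matI)
    fix i j assume "i < dim_row (1\<^sub>m n :: real mat)" "j < dim_col (1\<^sub>m n :: real mat)"
    then have ij: "i < n" "j < n" by auto
    have "(transpose_mat W * W) $$ (i, j) = col W i \<bullet> col W j"
      using ij by (simp add: W_def)
    also have "\<dots> = s i * s j * (ws ! i \<bullet> ws ! j)"
      using ij wc by (simp add: col scalar_prod_smult_distrib[of _ n] smult_scalar_prod_distrib[of _ n])
    also have "\<dots> = (if i = j then 1 else 0)"
      using orth[OF ij] pos[OF ij(1)] by (auto simp: s_def)
    finally show "(transpose_mat W * W) $$ (i, j) = 1\<^sub>m n $$ (i, j)"
      using ij by simp
  qed (auto simp: W_def)
  moreover have "W \<in> carrier_mat n n"
    by (simp add: W_def)
  ultimately show ?thesis
    using col[OF n] hd by metis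
qed

text \<open>Deflation: an orthogonal \<open>W\<close> whose first column is an eigenvector
  conjugates \<open>A\<close> to a block diagonal matrix with blocks \<open>c\<close> and a smaller
  symmetric \<open>B'\<close>, to which the induction hypothesis applies.\<close>

lemma real_spectral_theorem:
  fixes A :: "real mat"
  assumes "A \<in> carrier_mat n n" "transpose_mat A = A"
  shows "\<exists>Q d. Q \<in> carrier_mat n n \<and> transpose_mat Q * Q = 1\<^sub>m n \<and>
    A = Q * mat_diag n d * transpose_mat Q"
  using assms
proof (induction n arbitrary: A)
  case 0
  then show ?case
    by (intro exI[of _ A] exI[of _ "\<lambda>_. 0"]) (auto intro!: eq_matI)
next
  case (Suc n)
  note A = Suc.prems(1) and sym = Suc.prems(2)
  obtain c where "eigenvalue A c"
    using real_symmetric_has_eigenvalue[OF A sym] by auto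
  then obtain v where v: "v \<in> carrier_vec (Suc n)" "v \<noteq> 0\<^sub>v (Suc n)" "A *\<^sub>v v = c \<cdot>\<^sub>v v"
    using A unfolding eigenvalue_def eigenvector_def by auto
  then obtain W a where W: "W \<in> carrier_mat (Suc n) (Suc n)"
      "transpose_mat W * W = 1\<^sub>m (Suc n)" and col0: "col W 0 = a \<cdot>\<^sub>v v"
    using orthonormal_extension by blast
  have WT: "transpose_mat W \<in> carrier_mat (Suc n) (Suc n)"
    using W(1) by simp
  have WW: "W * transpose_mat W = 1\<^sub>m (Suc n)"
    using mat_mult_left_right_inverse[OF WT W(1) W(2)] .
  define B where "B = transpose_mat W * A * W"
  have B: "B \<in> carrier_mat (Suc n) (Suc n)"
    using W A by (auto simp: B_def)
  have AB: "A = W * B * transpose_mat W"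
  proof -
    have "W * B * transpose_mat W = (W * transpose_mat W) * A * (W * transpose_mat W)"
      unfolding B_def using W(1) WT A by (simp add: assoc_mult_mat[of _ "Suc n" "Suc n" _ "Suc n" _ "Suc n"])
    then show ?thesis
      using WW A by simp
  qed
  have symB: "transpose_mat B = B"
    unfolding B_def using W(1) WT A sym
    by (simp add: transpose_mult[of _ "Suc n" "Suc n" _ "Suc n"]
        assoc_mult_mat[of _ "Suc n" "Suc n" _ "Suc n" _ "Suc n"])
  have symB': "B $$ (i, j) = B $$ (j, i)" if "i < Suc n" "j < Suc n" for i j
    using that B arg_cong[OF symB, of "\<lambda>M. M $$ (i, j)"] by simp
  \<comment> \<open>Column 0 of \<open>W\<close> is a multiple of the eigenvector, and
    \<open>transpose_mat W\<close> sends it to the first unit vector. Symmetry of \<open>B\<close>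
    then clears row 0 as well.\<close>
  have colB: "B $$ (i, 0) = (if i = 0 then c else 0)" if i: "i < Suc n" for i
  proof -
    have "B = transpose_mat W * (A * W)"
      unfolding B_def by (rule assoc_mult_mat[OF WT A W(1)])
    moreover have "A * W \<in> carrier_mat (Suc n) (Suc n)"
      using A W(1) by simp
    ultimately have "col B 0 = transpose_mat W *\<^sub>v (A *\<^sub>v col W 0)"
      using col_mult2[OF WT, of "A * W" "Suc n" 0] col_mult2[OF A W(1), of 0] by simp
    also have "A *\<^sub>v col W 0 = c \<cdot>\<^sub>v col W 0"
      using A v by (simp add: col0 mult_mat_vec[of _ "Suc n" "Suc n"] smult_smult_assoc mult.commute)
    also have "transpose_mat W *\<^sub>v (c \<cdot>\<^sub>v col W 0) = c \<cdot>\<^sub>v col (transpose_mat W * W) 0"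
      using W(1) mult_mat_vec[OF WT, of "col W 0" c] col_mult2[OF WT W(1), of 0]
      by (simp add: carrier_vecI)
    finally have "col B 0 $ i = (c \<cdot>\<^sub>v col (1\<^sub>m (Suc n)) 0) $ i"
      by (simp add: W(2))
    then show ?thesis
      using i B by simp
  qed
  define B' where "B' = mat n n (\<lambda>(i, j). B $$ (Suc i, Suc j))"
  have B': "B' \<in> carrier_mat n n" "transpose_mat B' = B'"
    using symB' by (auto simp: B'_def)
  obtain P d where P: "P \<in> carrier_mat n n" "transpose_mat P * P = 1\<^sub>m n"
      "B' = P * mat_diag n d * transpose_mat P"
    using Suc.IH[OF B'] by blast
  \<comment> \<open>\<open>?four M a\<close> is block diagonal with blocks \<open>a\<close> and
    \<open>M\<close>. In \<open>?d\<close> the new eigenvalue sits at index 0 and the others shift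
    by one.\<close>
  let ?four = "\<lambda>M a. four_block_mat (mat 1 1 (\<lambda>_. a)) (0\<^sub>m 1 n) (0\<^sub>m n 1) M"
  let ?d = "\<lambda>i. case i of 0 \<Rightarrow> c | Suc j \<Rightarrow> d j"
  have mult: "?four M a * ?four M' a' = ?four (M * M') (a * a')"
    if "M \<in> carrier_mat n n" "M' \<in> carrier_mat n n" for M M' :: "real mat" and a a'
  proof -
    have "mat 1 1 (\<lambda>_. a) * mat 1 1 (\<lambda>_. a') = mat 1 1 (\<lambda>_. a * a')"
      by (rule eq_matI) (auto simp: scalar_prod_def)
    then show ?thesis
      using that by (subst mult_four_block_mat[of _ 1 1 _ n _ n _ _ 1 _ n]) auto
  qed
  have Beq: "B = ?four B' c"
    using B colB symB' by (intro eq_matI) (auto simp: B'_def)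
  have diag: "mat_diag (Suc n) ?d = ?four (mat_diag n d) c"
    by (rule eq_matI) (auto simp: mat_diag_def split: nat.split)
  have one: "?four (1\<^sub>m n) 1 = 1\<^sub>m (Suc n)"
    by (rule eq_matI) auto
  have trans: "transpose_mat (?four P 1) = ?four (transpose_mat P) 1"
    using P(1) by (subst transpose_four_block_mat[of _ 1 1 _ n _ n]) (auto intro!: arg_cong2[of _ _ _ _ "\<lambda>x y. four_block_mat x y _ _"])
  have F: "?four P 1 \<in> carrier_mat (Suc n) (Suc n)"
    using P(1) four_block_carrier_mat[of "mat 1 1 (\<lambda>_. 1)" 1 1 P n n] by simp
  have "B = ?four P 1 * mat_diag (Suc n) ?d * transpose_mat (?four P 1)"
    unfolding trans diag Beq P(3) mult[OF P(1) mat_diag_dim]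
      mult[OF mult_carrier_mat[OF P(1) mat_diag_dim] transpose_carrier_mat[THEN iffD2, OF P(1)]]
    by simp
  then have "A = (W * ?four P 1) * mat_diag (Suc n) ?d * transpose_mat (W * ?four P 1)"
    using AB W(1) WT F
    by (simp add: transpose_mult[of _ "Suc n" "Suc n" _ "Suc n"]
        mult_carrier_mat[of _ "Suc n" "Suc n" _ "Suc n"]
        assoc_mult_mat[of _ "Suc n" "Suc n" _ "Suc n" _ "Suc n"])
  moreover have "transpose_mat (W * ?four P 1) * (W * ?four P 1) = 1\<^sub>m (Suc n)"
  proof -
    have "transpose_mat (W * ?four P 1) * (W * ?four P 1)
        = transpose_mat (?four P 1) * ((transpose_mat W * W) * ?four P 1)"
      using W(1) WT F
      by (simp add: transpose_mult[of _ "Suc n" "Suc n" _ "Suc n"]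
          assoc_mult_mat[of _ "Suc n" "Suc n" _ "Suc n" _ "Suc n"])
    also have "\<dots> = ?four (transpose_mat P) 1 * ?four P 1"
      unfolding W(2) left_mult_one_mat[OF F] trans ..
    also have "\<dots> = 1\<^sub>m (Suc n)"
      unfolding mult[OF transpose_carrier_mat[THEN iffD2, OF P(1)] P(1)] P(2) using one by simp
    finally show ?thesis .
  qed
  moreover have "W * ?four P 1 \<in> carrier_mat (Suc n) (Suc n)"
    using W(1) F by simp
  ultimately show ?case
    by blast
qed

section \<open>Characteristic polynomials and projections of a diagonalised matrix\<close>

lemma orthogonal_diagonalization_mult_right:
  fixes A Q :: "'a::field mat"
  assumes Q: "Q \<in> carrier_mat n n" "transpose_mat Q * Q = 1\<^sub>m n"
    and A: "A = Q * mat_diag n d * transpose_mat Q"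
  shows "A * Q = Q * mat_diag n d"
proof -
  have QT: "transpose_mat Q \<in> carrier_mat n n"
    using Q by simp
  have "A * Q = Q * mat_diag n d * (transpose_mat Q * Q)"
    unfolding A using Q(1) QT mult_carrier_mat[OF Q(1) mat_diag_dim] by (intro assoc_mult_mat)
  then show ?thesis
    using Q right_mult_one_mat[OF mult_carrier_mat[OF Q(1) mat_diag_dim[of n d]]] by simp
qed

lemma char_poly_spectral:
  fixes A Q :: "'a::field mat"
  assumes Q: "Q \<in> carrier_mat n n" "transpose_mat Q * Q = 1\<^sub>m n"
    and A: "A = Q * mat_diag n d * transpose_mat Q"
  shows "char_poly A = (\<Prod>i<n. [:- d i, 1:])"
proof -
  have QT: "transpose_mat Q \<in> carrier_mat n n"
    using Q by simp
  have "similar_mat_wit A (mat_diag n d) Q (transpose_mat Q)"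
    using Q QT mat_mult_left_right_inverse[OF QT Q] A by (intro similar_mat_witI) auto
  then have "char_poly A = char_poly (mat_diag n d)"
    by (intro char_poly_similar) (auto simp: similar_mat_def)
  also have "\<dots> = (\<Prod>a\<leftarrow>diag_mat (mat_diag n d). [:- a, 1:])"
    by (rule char_poly_upper_triangular[of _ n]) (auto simp: mat_diag_def)
  also have "diag_mat (mat_diag n d) = map d [0..<n]"
    by (auto simp: diag_mat_def mat_diag_def)
  finally show ?thesis
    by (simp add: prod.distinct_set_conv_list[symmetric] atLeast0LessThan o_def)
qed

lemma mat_delete_char_poly_matrix:
  assumes "A \<in> carrier_mat n n" "u < n"
  shows "mat_delete (char_poly_matrix A) u u = char_poly_matrix (mat_delete A u u)"
  using assms by (intro eq_matI) (auto simp: char_poly_matrix_def mat_delete_def)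

text \<open>The left side is a diagonal cofactor of \<open>M = x I - A\<close>. The diagonalisation
  suggests \<open>Q diag(\<phi> / (x - d i)) Q^T\<close> as adjugate; each quotient is the product
  \<open>?p i\<close>, so the candidate \<open>N\<close> has polynomial entries.\<close>

lemma char_poly_mat_delete_spectral:
  fixes A Q :: "'a::field mat"
  assumes Q: "Q \<in> carrier_mat n n" "transpose_mat Q * Q = 1\<^sub>m n"
    and A: "A = Q * mat_diag n d * transpose_mat Q" and u: "u < n"
  shows "char_poly (mat_delete A u u)
    = (\<Sum>i<n. Polynomial.smult ((Q $$ (u, i))\<^sup>2) (\<Prod>j\<in>{..<n} - {i}. [:- d j, 1:]))"
proof -
  let ?C = "map_mat (\<lambda>a. [:a:]) :: 'a mat \<Rightarrow> 'a poly mat"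
  let ?p = "\<lambda>i. \<Prod>j\<in>{..<n} - {i}. [:- d j, 1:]"
  let ?\<phi> = "\<Prod>i<n. [:- d i, 1:]"
  define M where "M = char_poly_matrix A"
  define R where "R = transpose_mat (?C Q)"
  define N where "N = ?C Q * (mat_diag n ?p * R)"
  have QT: "transpose_mat Q \<in> carrier_mat n n"
    using Q by simp
  have A': "A \<in> carrier_mat n n"
    unfolding A using Q(1) mult_carrier_mat[OF mult_carrier_mat[OF Q(1) mat_diag_dim] QT] by simp
  have M: "M \<in> carrier_mat n n"
    using A' by (simp add: M_def)
  have CQ: "?C Q \<in> carrier_mat n n" and R: "R \<in> carrier_mat n n"
    using Q by (auto simp: R_def)
  have D: "mat_diag n ?p * R \<in> carrier_mat n n"
    using R mat_diag_dim by (rule mult_carrier_mat[rotated])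
  have N: "N \<in> carrier_mat n n"
    unfolding N_def using CQ D by simp
  have one: "?C (1\<^sub>m n) = 1\<^sub>m n"
    by (rule eq_matI) auto
  have "Q * transpose_mat Q = 1\<^sub>m n"
    using mat_mult_left_right_inverse[OF QT Q] .
  then have CR: "?C Q * R = 1\<^sub>m n"
    using map_poly_mult(1)[OF Q(1) QT] by (simp add: one R_def map_mat_transpose)
  have det: "det M = ?\<phi>"
    using char_poly_spectral[OF assms(1-3)] by (simp add: char_poly_def M_def)
  \<comment> \<open>This is \<open>(x I - A) Q = Q (x I - D)\<close>, the relation
    \<open>A Q = Q D\<close> lifted to polynomial matrices.\<close>
  have MC: "M * ?C Q = ?C Q * mat_diag n (\<lambda>i. [:- d i, 1:])"
  proof -
    have "map_mat (\<lambda>a. [:- a:]) A = - ?C A"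
      by (rule eq_matI) auto
    then have "M = [:0, 1:] \<cdot>\<^sub>m 1\<^sub>m n - ?C A"
      using A' unfolding M_def char_poly_matrix_def by (intro eq_matI) auto
    then have "M * ?C Q = [:0, 1:] \<cdot>\<^sub>m ?C Q - ?C A * ?C Q"
      using A' CQ
      by (simp add: minus_mult_distrib_mat[of _ n n] mult_smult_assoc_mat[OF one_carrier_mat CQ])
    also have "?C A * ?C Q = ?C (Q * mat_diag n d)"
      using map_poly_mult(1)[OF A' Q(1)] orthogonal_diagonalization_mult_right[OF assms(1-3)] by simp
    finally show ?thesis
      using Q(1) by (auto simp: mat_diag_mult_right[OF CQ] mat_diag_mult_right[OF Q(1)] intro!: eq_matI)
  qed
  have "M * N = (M * ?C Q) * (mat_diag n ?p * R)"
    unfolding N_def by (rule assoc_mult_mat[OF M CQ D, symmetric])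
  also have "\<dots> = ?C Q * (mat_diag n (\<lambda>i. [:- d i, 1:]) * (mat_diag n ?p * R))"
    unfolding MC by (rule assoc_mult_mat[OF CQ mat_diag_dim D])
  also have "mat_diag n (\<lambda>i. [:- d i, 1:]) * (mat_diag n ?p * R) = ?\<phi> \<cdot>\<^sub>m R"
  proof -
    have "[:- d i, 1:] * ?p i = ?\<phi>" if "i < n" for i
      using that by (subst prod.remove[of "{..<n}" i]) auto
    then have "mat_diag n (\<lambda>i. [:- d i, 1:] * ?p i) = ?\<phi> \<cdot>\<^sub>m 1\<^sub>m n"
      by (intro eq_matI) (auto simp: mat_diag_def)
    then show ?thesis
      using R by (simp add: assoc_mult_mat[OF mat_diag_dim mat_diag_dim R, symmetric]
          mult_smult_assoc_mat[OF one_carrier_mat R])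
  qed
  \<comment> \<open>\<open>N\<close> and the adjugate are both inverse to \<open>M\<close> up to the nonzero factor \<open>\<phi>\<close>.\<close>
  finally have MN: "M * N = ?\<phi> \<cdot>\<^sub>m 1\<^sub>m n"
    using CR by (simp add: mult_smult_distrib[OF CQ R])
  have adj: "adj_mat M \<in> carrier_mat n n" "adj_mat M * M = ?\<phi> \<cdot>\<^sub>m 1\<^sub>m n"
    using adj_mat[OF M] det by auto
  have "?\<phi> \<cdot>\<^sub>m adj_mat M = adj_mat M * (M * N)"
    using adj MN by (simp add: mult_smult_distrib[OF adj(1) one_carrier_mat])
  also have "\<dots> = ?\<phi> \<cdot>\<^sub>m N"
    using assoc_mult_mat[OF adj(1) M N] adj(2) N by (simp add: mult_smult_assoc_mat[OF one_carrier_mat N])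
  finally have "(?\<phi> \<cdot>\<^sub>m adj_mat M) $$ (u, u) = (?\<phi> \<cdot>\<^sub>m N) $$ (u, u)"
    by simp
  then have "adj_mat M $$ (u, u) = N $$ (u, u)"
    using u adj(1) N by simp
  \<comment> \<open>At a diagonal position the cofactor sign is
    \<open>(-1)^(u + u) = 1\<close>.\<close>
  moreover have "adj_mat M $$ (u, u) = char_poly (mat_delete A u u)"
    using u M mat_delete_char_poly_matrix[OF A' u]
    by (simp add: adj_mat_def cofactor_def char_poly_def M_def)
  moreover have "N $$ (u, u) = (\<Sum>i<n. Polynomial.smult ((Q $$ (u, i))\<^sup>2) (?p i))"
    using u Q(1) unfolding N_def mat_diag_mult_left[OF R]
    by (auto simp: scalar_prod_def R_def atLeast0LessThan power2_eq_square intro!: sum.cong)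
  ultimately show ?thesis
    by simp
qed

section \<open>Orthogonal projections onto eigenspaces\<close>

text \<open>Two candidates applied to the same \<open>v\<close> differ by an element of
  \<open>W\<close> that is orthogonal to \<open>W\<close>, hence to itself, hence zero. This
  resolves the definite description in \<open>orth_proj_mat\<close>.\<close>

lemma orth_proj_mat_eqI:
  assumes P: "P \<in> carrier_mat n n"
    and W: "W \<subseteq> carrier_vec n" "\<And>v w. v \<in> W \<Longrightarrow> w \<in> W \<Longrightarrow> v - w \<in> W"
    and in_W: "\<And>v. v \<in> carrier_vec n \<Longrightarrow> P *\<^sub>v v \<in> W"
    and orth: "\<And>v w. v \<in> carrier_vec n \<Longrightarrow> w \<in> W \<Longrightarrow> (v - P *\<^sub>v v) \<bullet> w = 0"
  shows "orth_proj_mat n W = P"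
  unfolding orth_proj_mat_def
proof (rule the_equality)
  fix P' assume "P' \<in> carrier_mat n n \<and>
     (\<forall>v\<in>carrier_vec n. P' *\<^sub>v v \<in> W \<and> (\<forall>w\<in>W. (v - P' *\<^sub>v v) \<bullet> w = 0))"
  then have P': "P' \<in> carrier_mat n n" and in_W': "\<And>v. v \<in> carrier_vec n \<Longrightarrow> P' *\<^sub>v v \<in> W"
    and orth': "\<And>v w. v \<in> carrier_vec n \<Longrightarrow> w \<in> W \<Longrightarrow> (v - P' *\<^sub>v v) \<bullet> w = 0"
    by auto
  have eq: "P' *\<^sub>v v = P *\<^sub>v v" if v: "v \<in> carrier_vec n" for v
  proof -
    let ?x = "P' *\<^sub>v v" and ?y = "P *\<^sub>v v"
    have c: "?x \<in> carrier_vec n" "?y \<in> carrier_vec n"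
      using P P' v by auto
    have xy: "?x - ?y \<in> W" "?x - ?y \<in> carrier_vec n"
      using W in_W[OF v] in_W'[OF v] by blast+
    have diff: "(v - y) - (v - x) = x - y" if "x \<in> carrier_vec n" "y \<in> carrier_vec n" for x y
      using that v by (intro eq_vecI) auto
    \<comment> \<open>Both \<open>v - ?y\<close> and \<open>v - ?x\<close> are orthogonal to
      \<open>W\<close>, in particular to \<open>?x - ?y\<close>.\<close>
    have "(?x - ?y) \<bullet> (?x - ?y) = ((v - ?y) - (v - ?x)) \<bullet> (?x - ?y)"
      unfolding diff[OF c] ..
    also have "\<dots> = 0"
      using orth[OF v xy(1)] orth'[OF v xy(1)] v c
      by (subst minus_scalar_prod_distrib[of _ n]) auto
    finally have "(?x - ?y) \<bullet>c (?x - ?y) = 0"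
      by (simp add: scalar_prod_def)
    then have zero: "?x - ?y = 0\<^sub>v n"
      using conjugate_square_eq_0_vec[OF xy(2)] by simp
    show ?thesis
    proof (rule eq_vecI)
      fix i assume i: "i < dim_vec ?y"
      then have "i < n" by (simp only: carrier_vecD[OF c(2)])
      then show "?x $ i = ?y $ i"
        using arg_cong[OF zero, of "\<lambda>v. v $ i"] index_minus_vec(1)[OF i, of ?x]
        by (simp del: index_mult_mat_vec index_minus_vec)
    qed (simp only: carrier_vecD[OF c(1)] carrier_vecD[OF c(2)])
  qed
  have "col P' j = col P j" if "j < n" for j
    using eq[of "unit_vec n j"] that P P'
    by (metis col_mult2 col_one one_carrier_mat right_mult_one_mat unit_vec_carrier)
  then show "P' = P"
    using P P' by (intro mat_col_eqI) auto
qed (use assms in blast)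

text \<open>The projection is \<open>P = Q diag(e) Q^T\<close> with \<open>e\<close> the indicator
  of \<open>d i = c\<close>. It maps into the eigenspace because \<open>A P = c P\<close>; it fixes
  the eigenspace and is symmetric, so \<open>v - P v\<close> is orthogonal to the
  eigenspace.\<close>

lemma spectral_idempotent_diag:
  fixes Q :: "real mat"
  assumes Q: "Q \<in> carrier_mat n n" "transpose_mat Q * Q = 1\<^sub>m n"
    and A: "A = Q * mat_diag n d * transpose_mat Q" and u: "u < n"
  shows "spectral_idempotent A c $$ (u, u) = (\<Sum>i | i < n \<and> d i = c. (Q $$ (u, i))\<^sup>2)"
proof -
  define e where "e i = (if d i = c then 1 else 0 :: real)" for i
  define P where "P = Q * (mat_diag n e * transpose_mat Q)"
  have QT: "transpose_mat Q \<in> carrier_mat n n"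
    using Q by simp
  have QQT: "Q * transpose_mat Q = 1\<^sub>m n"
    using mat_mult_left_right_inverse[OF QT Q] .
  have A': "A \<in> carrier_mat n n"
    unfolding A using Q(1) mult_carrier_mat[OF mult_carrier_mat[OF Q(1) mat_diag_dim] QT] by simp
  have D: "mat_diag n f * transpose_mat Q \<in> carrier_mat n n" for f :: "nat \<Rightarrow> real"
    using QT mat_diag_dim by (rule mult_carrier_mat[rotated])
  have P: "P \<in> carrier_mat n n"
    unfolding P_def using Q(1) D by simp
  have W: "eigenspace A c = {v \<in> carrier_vec n. A *\<^sub>v v = c \<cdot>\<^sub>v v}"
    using A' by (simp add: eigenspace_def)
  have AP: "A * P = c \<cdot>\<^sub>m P"
  proof -
    have "A * P = (A * Q) * (mat_diag n e * transpose_mat Q)"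
      unfolding P_def by (rule assoc_mult_mat[OF A' Q(1) D, symmetric])
    also have "\<dots> = Q * (mat_diag n d * (mat_diag n e * transpose_mat Q))"
      unfolding orthogonal_diagonalization_mult_right[OF assms(1-3)]
      by (rule assoc_mult_mat[OF Q(1) mat_diag_dim D])
    also have "mat_diag n d * (mat_diag n e * transpose_mat Q) = mat_diag n (\<lambda>i. d i * e i) * transpose_mat Q"
      by (simp add: assoc_mult_mat[OF mat_diag_dim mat_diag_dim QT, symmetric])
    also have "mat_diag n (\<lambda>i. d i * e i) = c \<cdot>\<^sub>m mat_diag n e"
      by (rule eq_matI) (auto simp: mat_diag_def e_def)
    finally show ?thesis
      using Q(1) QT D by (simp add: P_def mult_smult_assoc_mat[OF mat_diag_dim QT] mult_smult_distrib[OF Q(1) D])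
  qed
  have symP: "transpose_mat P = P"
  proof -
    have "transpose_mat (mat_diag n e) = mat_diag n e"
      by (rule eq_matI) (auto simp: mat_diag_def)
    then show ?thesis
      unfolding P_def transpose_mult[OF Q(1) D] transpose_mult[OF mat_diag_dim QT]
      by (simp add: assoc_mult_mat[OF Q(1) mat_diag_dim QT])
  qed
  \<comment> \<open>In the coordinates \<open>z = Q^T w\<close> the eigenvector equation reads
    \<open>d i * z i = c * z i\<close>, so \<open>z\<close> is supported where
    \<open>d i = c\<close> and multiplication by \<open>e\<close> leaves it unchanged.\<close>
  have P_id: "P *\<^sub>v w = w" if w: "w \<in> carrier_vec n" "A *\<^sub>v w = c \<cdot>\<^sub>v w" for w
  proof -
    define z where "z = transpose_mat Q *\<^sub>v w"
    have z: "z \<in> carrier_vec n"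
      using QT w by (simp add: z_def)
    have QzE: "Q *\<^sub>v z = w"
      unfolding z_def using QQT w by (simp add: assoc_mult_mat_vec[OF Q(1) QT, symmetric])
    have "transpose_mat Q *\<^sub>v (A *\<^sub>v w) = mat_diag n d *\<^sub>v z"
    proof -
      have "A *\<^sub>v w = (A * Q) *\<^sub>v z"
        using QzE assoc_mult_mat_vec[OF A' Q(1) z] by simp
      also have "\<dots> = Q *\<^sub>v (mat_diag n d *\<^sub>v z)"
        unfolding orthogonal_diagonalization_mult_right[OF assms(1-3)]
        by (rule assoc_mult_mat_vec[OF Q(1) mat_diag_dim z])
      finally have "transpose_mat Q *\<^sub>v (A *\<^sub>v w) = (transpose_mat Q * Q) *\<^sub>v (mat_diag n d *\<^sub>v z)"
        using assoc_mult_mat_vec[OF QT Q(1), of "mat_diag n d *\<^sub>v z"]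
          mult_mat_vec_carrier[OF mat_diag_dim z] by simp
      then show ?thesis
        using Q(2) mult_mat_vec_carrier[OF mat_diag_dim z] by simp
    qed
    then have dz: "mat_diag n d *\<^sub>v z = c \<cdot>\<^sub>v z"
      unfolding w(2) using mult_mat_vec[OF QT w(1)] by (simp add: z_def)
    have diag_vec: "(mat_diag n f *\<^sub>v z) $ i = f i * z $ i" if "i < n" for f i
      using that z by (simp add: mat_diag_def scalar_prod_def if_distrib[of "\<lambda>x. x * _"] sum.delta cong: if_cong)
    have "mat_diag n e *\<^sub>v z = z"
    proof (rule eq_vecI)
      fix i assume "i < dim_vec z"
      then have i: "i < n" using z by simp
      have "d i * z $ i = c * z $ i"
        using arg_cong[OF dz, of "\<lambda>v. v $ i"] diag_vec[OF i] i z by simp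
      then show "(mat_diag n e *\<^sub>v z) $ i = z $ i"
        using diag_vec[OF i] by (auto simp: e_def)
    qed (use z in \<open>simp add: mat_diag_def\<close>)
    moreover have "P *\<^sub>v w = Q *\<^sub>v (mat_diag n e *\<^sub>v z)"
      unfolding P_def z_def using w
      by (simp add: assoc_mult_mat_vec[OF Q(1) D] assoc_mult_mat_vec[OF mat_diag_dim QT])
    ultimately show ?thesis
      using QzE by simp
  qed
  have "orth_proj_mat n (eigenspace A c) = P"
  proof (rule orth_proj_mat_eqI[OF P])
    show "eigenspace A c \<subseteq> carrier_vec n"
      by (auto simp: W)
    show "v - w \<in> eigenspace A c" if "v \<in> eigenspace A c" "w \<in> eigenspace A c" for v w
    proof -
      have vw: "v \<in> carrier_vec n" "w \<in> carrier_vec n" "A *\<^sub>v v = c \<cdot>\<^sub>v v" "A *\<^sub>v w = c \<cdot>\<^sub>v w"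
        using that by (auto simp: W)
      have "A *\<^sub>v (v - w) = c \<cdot>\<^sub>v v - c \<cdot>\<^sub>v w"
        using mult_minus_distrib_mat_vec[OF A' vw(1,2)] vw by simp
      also have "\<dots> = c \<cdot>\<^sub>v (v - w)"
        using vw by (intro eq_vecI) (auto simp: right_diff_distrib)
      finally show ?thesis
        using vw by (simp add: W)
    qed
    show "P *\<^sub>v v \<in> eigenspace A c" if v: "v \<in> carrier_vec n" for v
    proof -
      have "A *\<^sub>v (P *\<^sub>v v) = (c \<cdot>\<^sub>m P) *\<^sub>v v"
        using assoc_mult_mat_vec[OF A' P v] by (simp add: AP)
      also have "\<dots> = c \<cdot>\<^sub>v (P *\<^sub>v v)"
        using P v by (intro eq_vecI) (auto simp: smult_scalar_prod_distrib[of _ n])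
      finally show ?thesis
        using P v by (simp add: W)
    qed
    show "(v - P *\<^sub>v v) \<bullet> w = 0" if v: "v \<in> carrier_vec n" and w: "w \<in> eigenspace A c" for v w
    proof -
      have w': "w \<in> carrier_vec n" "P *\<^sub>v w = w"
        using w P_id by (auto simp: W)
      have "(P *\<^sub>v v) \<bullet> w = w \<bullet> (P *\<^sub>v v)"
        by (rule comm_scalar_prod[OF mult_mat_vec_carrier[OF P v] w'(1)])
      also have "\<dots> = (P *\<^sub>v w) \<bullet> v"
        using transpose_vec_mult_scalar[OF P v w'(1)] by (simp only: symP)
      also have "\<dots> = v \<bullet> w"
        unfolding w'(2) by (rule comm_scalar_prod[OF w'(1) v])
      finally show ?thesis
        by (simp only: minus_scalar_prod_distrib[OF v mult_mat_vec_carrier[OF P v] w'(1)] diff_self)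
    qed
  qed
  then have "spectral_idempotent A c $$ (u, u) = P $$ (u, u)"
    using A' by (simp add: spectral_idempotent_def)
  also have "\<dots> = (\<Sum>i<n. (Q $$ (u, i))\<^sup>2 * e i)"
    using u Q(1) unfolding P_def mat_diag_mult_left[OF QT]
    by (auto simp: scalar_prod_def atLeast0LessThan power2_eq_square intro!: sum.cong)
  also have "\<dots> = (\<Sum>i | i < n \<and> d i = c. (Q $$ (u, i))\<^sup>2)"
    by (simp add: e_def if_distrib sum.If_cases cong: if_cong) (auto intro!: sum.cong)
  finally show ?thesis .
qed

section \<open>Laplacians\<close>

lemma laplacian_carrier: "laplacian G vs \<in> carrier_mat (length vs) (length vs)"
  by (rule carrier_matI) (simp_all add: laplacian_def degree_mat_def adjacency_mat_def)

text \<open>All entries are integers. Through this, \<open>lap_poly\<close> and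
  \<open>lap_poly_del\<close> become characteristic polynomials of real matrices, to which the
  spectral decomposition applies.\<close>

lemma map_mat_of_rat_laplacian:
  "map_mat of_rat (laplacian G vs) = (laplacian G vs :: 'b::field_char_0 mat)"
  by (rule eq_matI) (auto simp: laplacian_def degree_mat_def adjacency_mat_def of_rat_diff)

lemma laplacian_symmetric:
  assumes "sym (parcs G)"
  shows "transpose_mat (laplacian G vs) = laplacian G vs"
  using assms
  by (intro eq_matI) (auto simp: laplacian_def degree_mat_def adjacency_mat_def dest: symD)

lemma map_poly_lap_poly:
  "map_poly of_rat (lap_poly G vs) = (char_poly (laplacian G vs) :: 'b::field_char_0 poly)"
  unfolding lap_poly_def of_rat_hom.char_poly_hom[OF laplacian_carrier, symmetric]
    map_mat_of_rat_laplacian ..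

lemma map_poly_lap_poly_del:
  assumes "u < length vs"
  shows "map_poly of_rat (lap_poly_del G vs u)
    = (char_poly (mat_delete (laplacian G vs) u u) :: 'b::field_char_0 poly)"
proof -
  let ?L = "laplacian G vs :: rat mat"
  have L: "?L \<in> carrier_mat (length vs) (length vs)"
    by (rule laplacian_carrier)
  have "map_mat of_rat (mat_delete ?L u u) = mat_delete (map_mat of_rat ?L :: 'b mat) u u"
    using L assms by (intro eq_matI) (auto simp: mat_delete_def)
  moreover have "mat_delete ?L u u \<in> carrier_mat (length vs - 1) (length vs - 1)"
    using mat_delete_carrier[OF L] by simp
  ultimately show ?thesis
    unfolding lap_poly_del_def map_mat_of_rat_laplacian by (metis of_rat_hom.char_poly_hom)
qed

section \<open>Assembly of the trace formula\<close>

theorem theorem4p2: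
  fixes G :: "'a pair_pre_digraph" and vs :: "'a list"
    and k :: nat and f :: "nat \<Rightarrow> rat poly" and m :: "nat \<Rightarrow> nat"
  assumes "pair_graph G"
    and "distinct vs" and "set vs = pverts G"
    and "lap_poly G vs = (\<Prod>i=1..k. f i ^ m i)"
    and "\<And>i. i \<in> {1..k} \<Longrightarrow> m i \<ge> 1"
    and "\<And>i. i \<in> {1..k} \<Longrightarrow> irreducible (f i)"
    and "\<And>i j. i \<in> {1..k} \<Longrightarrow> j \<in> {1..k} \<Longrightarrow> i \<noteq> j \<Longrightarrow> gcd (f i) (f j) = 1"
  shows "laziness G vs =
    (\<Sum>i=1..k. \<Sum>u<length vs. of_rat (quot_trace (f i) ((psi G vs (f i) (m i) u)\<^sup>2)))"
proof -
  define n where "n = length vs"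
  define L where "L = (laplacian G vs :: real mat)"
  define R where "R i = {x :: real. poly (map_poly of_rat (f i)) x = 0}" for i
  let ?h = "map_poly of_rat :: rat poly \<Rightarrow> real poly"
  have L: "L \<in> carrier_mat n n"
    unfolding L_def n_def by (rule laplacian_carrier)
  interpret pair_graph G by fact
  have "sym (parcs G)"
    using sym_arcs by (simp add: symmetric_def)
  then have "transpose_mat L = L"
    unfolding L_def by (rule laplacian_symmetric)
  then obtain Q d where Q: "Q \<in> carrier_mat n n" "transpose_mat Q * Q = 1\<^sub>m n"
    and LQ: "L = Q * mat_diag n d * transpose_mat Q"
    using real_spectral_theorem[OF L] by blast
  \<comment> \<open>By \<open>spectral_idempotent_diag\<close> this is the diagonal entry at
    \<open>u\<close> of the spectral idempotent for \<open>x\<close>.\<close>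
  define E where "E x u = (\<Sum>i | i < n \<and> d i = x. (Q $$ (u, i))\<^sup>2)" for x u
  have phi: "?h (lap_poly G vs) = (\<Prod>j<n. [:- d j, 1:])"
    using char_poly_spectral[OF Q LQ] by (simp add: map_poly_lap_poly L_def)
  then have prod: "(\<Prod>i=1..k. ?h (f i) ^ m i) = (\<Prod>j<n. [:- d j, 1:])"
    using assms(4) by (simp add: of_rat_poly_hom.hom_prod of_rat_poly_hom.hom_power)
  have eigenvalues: "{c. eigenvalue L c} = (\<Union>i\<in>{1..k}. R i)"
  proof -
    have "eigenvalue L c \<longleftrightarrow> poly (\<Prod>i=1..k. ?h (f i) ^ m i) c = 0" for c
      using eigenvalue_root_char_poly[OF L] char_poly_spectral[OF Q LQ] prod by simp
    \<comment> \<open>Since \<open>m i \<ge> 1\<close>, every root of every \<open>f i\<close> is a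
      root of the product.\<close>
    also have "\<dots> c \<longleftrightarrow> (\<exists>i\<in>{1..k}. c \<in> R i)" for c
      using assms(5) by (force simp: R_def poly_prod)
    finally show ?thesis
      by auto
  qed
  have fin: "finite (R i)" if "i \<in> {1..k}" for i
  proof -
    have "f i \<noteq> 0"
      using assms(6)[OF that] by auto
    then show ?thesis
      unfolding R_def by (intro poly_roots_finite) simp
  qed
  have disj: "R i \<inter> R j = {}" if "i \<in> {1..k}" "j \<in> {1..k}" "i \<noteq> j" for i j
    using coprime_no_common_root[of "f i" "f j"] assms(7)[OF that]
    by (auto simp: R_def coprime_iff_gcd_eq_1)
  \<comment> \<open>Writing \<open>f i\<close> as the linear factor at \<open>x\<close> times
    \<open>q\<close>, simplicity of the root gives \<open>q\<close> a nonzero value at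
    \<open>x\<close>, and disjointness does the same for the other \<open>f j\<close>. So the order
    of the product at \<open>x\<close> is exactly \<open>m i\<close>.\<close>
  have mult: "card {j \<in> {..<n}. d j = x} = m i" if i: "i \<in> {1..k}" and x: "x \<in> R i" for i x
  proof -
    obtain q where q: "?h (f i) = [:- x, 1:] * q"
      using x by (auto simp: R_def poly_eq_0_iff_dvd)
    have "poly (pderiv (?h (f i))) x \<noteq> 0"
      using irreducible_simple_root[OF assms(6)[OF i]] x by (simp add: R_def)
    moreover have "poly (pderiv (?h (f i))) x = poly q x"
      unfolding q pderiv_mult poly_add poly_mult by (simp add: pderiv_pCons)
    ultimately have "poly q x \<noteq> 0"
      by simp
    moreover have "poly (?h (f j)) x \<noteq> 0" if "j \<in> {1..k} - {i}" for j
      using disj[of i j] i that x by (auto simp: R_def)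
    ultimately have nz: "poly (q ^ m i * (\<Prod>j\<in>{1..k} - {i}. ?h (f j) ^ m j)) x \<noteq> 0"
      by (auto simp: poly_prod)
    have eq: "(\<Prod>j<n. [:- d j, 1:]) = [:- x, 1:] ^ m i * (q ^ m i * (\<Prod>j\<in>{1..k} - {i}. ?h (f j) ^ m j))"
      unfolding prod[symmetric] using i
      by (subst prod.remove[of _ i]) (simp_all only: finite_atLeastAtMost q power_mult_distrib mult.assoc)
    have "Polynomial.order x (\<Prod>j<n. [:- d j, 1:]) = m i"
      unfolding eq by (rule order_linear_power_mult[OF nz])
    then show ?thesis
      by (simp add: order_prod_linear)
  qed
  have psi: "poly (?h (psi G vs (f i) (m i) u)) x = E x u"
    if i: "i \<in> {1..k}" and x: "x \<in> R i" and u: "u < n" for i x u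
  proof -
    have root: "poly (?h (f i)) x = 0"
      using x by (simp add: R_def)
    have m: "m i = card {j \<in> {..<n}. d j = x}" "m i > 0"
      using mult[OF i x] assms(5)[OF i] by auto
    \<comment> \<open>\<open>N\<close> and \<open>D\<close> are the values at \<open>x\<close> of
      the two derivatives whose quotient, times \<open>m i\<close>, is psi.\<close>
    define N where "N = poly ((pderiv ^^ (m i - 1)) (?h (lap_poly_del G vs u))) x"
    define D where "D = poly ((pderiv ^^ m i) (?h (lap_poly G vs))) x"
    have del: "?h (lap_poly_del G vs u)
        = (\<Sum>i<n. Polynomial.smult ((Q $$ (u, i))\<^sup>2) (\<Prod>j\<in>{..<n} - {i}. [:- d j, 1:]))"
      using char_poly_mat_delete_spectral[OF Q LQ u] u
      by (simp add: map_poly_lap_poly_del n_def L_def)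
    have D: "D \<noteq> 0"
      unfolding D_def phi by (rule higher_pderiv_partial_fraction(2)[OF _ m]) simp
    have "of_nat (m i) * N = E x u * D"
      unfolding N_def D_def phi del E_def
      using higher_pderiv_partial_fraction(1)[OF _ m, of "\<lambda>i. (Q $$ (u, i))\<^sup>2"] by simp
    \<comment> \<open>\<open>D \<noteq> 0\<close> shows that the irreducible \<open>f i\<close> does
      not divide the denominator, so the modular inverse in \<open>psi\<close> is a genuine
      inverse.\<close>
    moreover have "coprime ((pderiv ^^ m i) (lap_poly G vs)) (f i)"
    proof -
      have "\<not> f i dvd (pderiv ^^ m i) (lap_poly G vs)"
      proof
        assume "f i dvd (pderiv ^^ m i) (lap_poly G vs)"
        then obtain r where "(pderiv ^^ m i) (lap_poly G vs) = f i * r"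
          by (elim dvdE)
        then have "D = 0"
          using root by (simp add: D_def of_rat_hom.map_poly_higher_pderiv[symmetric] of_rat_poly_hom.hom_mult)
        then show False
          using D by simp
      qed
      then show ?thesis
        using assms(6)[OF i] prime_elem_imp_coprime[OF irreducible_imp_prime_elem_gcd]
        by (simp add: coprime_commute)
    qed
    then have "poly (?h (modular_inverse (f i) ((pderiv ^^ m i) (lap_poly G vs)))) x = inverse D"
      using modular_inverse_root[OF _ root] by (simp add: D_def of_rat_hom.map_poly_higher_pderiv)
    ultimately have "of_nat (m i) * N * inverse D = E x u"
      "poly (?h (psi G vs (f i) (m i) u)) x = of_nat (m i) * N * inverse D"
      using D unfolding psi_def poly_hom_mod_root[OF root]
      by (simp_all add: of_rat_poly_hom.hom_mult of_rat_poly_hom.hom_of_nat N_def of_rat_hom.map_poly_higher_pderiv)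
    then show ?thesis
      by simp
  qed
  have trace: "of_rat (quot_trace (f i) ((psi G vs (f i) (m i) u)\<^sup>2)) = (\<Sum>x\<in>R i. (E x u)\<^sup>2)"
    if i: "i \<in> {1..k}" and u: "u < n" for i u
  proof -
    \<comment> \<open>Because \<open>m i \<ge> 1\<close>, \<open>f i\<close> divides a polynomial
      that splits over the reals. Its roots are therefore all real and, by irreducibility, simple,
      as the trace formula requires.\<close>
    have "?h (f i) dvd (\<Prod>j<n. [:- d j, 1:])"
      unfolding prod[symmetric] using i assms(5)[OF i] by (intro dvd_trans[OF _ dvd_prodI]) (auto intro: dvd_power)
    then have "card (R i) = degree (?h (f i))"
      unfolding R_def using irreducible_simple_root[OF assms(6)[OF i], where 'a = real]
      by (intro card_roots_eq_degree[of "{..<n}" _ d]) auto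
    then have "of_rat (quot_trace (f i) ((psi G vs (f i) (m i) u)\<^sup>2))
        = (\<Sum>x\<in>R i. poly (?h ((psi G vs (f i) (m i) u)\<^sup>2)) x)"
      using assms(6)[OF i] unfolding R_def by (intro quot_trace_eq_sum_roots) auto
    also have "\<dots> = (\<Sum>x\<in>R i. (E x u)\<^sup>2)"
      by (rule sum.cong) (simp_all add: of_rat_poly_hom.hom_power psi[OF i _ u])
    finally show ?thesis .
  qed
  have "laziness G vs = (\<Sum>c | eigenvalue L c. \<Sum>u<n. (E c u)\<^sup>2)"
    unfolding laziness_def L_def[symmetric] n_def[symmetric]
    by (intro sum.cong refl) (simp add: spectral_idempotent_diag[OF Q LQ] E_def)
  \<comment> \<open>The disjoint sets \<open>R i\<close> exhaust the spectrum, so the sum over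
    eigenvalues regroups by irreducible factor.\<close>
  also have "\<dots> = (\<Sum>i=1..k. \<Sum>c\<in>R i. \<Sum>u<n. (E c u)\<^sup>2)"
    unfolding eigenvalues using fin disj by (intro sum.UNION_disjoint) auto
  also have "\<dots> = (\<Sum>i=1..k. \<Sum>u<n. \<Sum>c\<in>R i. (E c u)\<^sup>2)"
    by (intro sum.cong refl sum.swap)
  also have "\<dots> = (\<Sum>i=1..k. \<Sum>u<n. of_rat (quot_trace (f i) ((psi G vs (f i) (m i) u)\<^sup>2)))"
    by (intro sum.cong refl) (simp add: trace)
  finally show ?thesis
    by (simp add: n_def)
qed

end
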